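(* Let $t \ge s \ge 1$ be integers. Then for all sufficiently large $n$, (1) $\displaystyle \mathrm{sat}(n,S_{t+1,s+1}) \le \frac{\left(\left\lceil\frac{t+1}{s}\right\rceil+1\right)s}{\left(\left\lceil\frac{t+1}{s}\right\rceil+1\right)s+1}\cdot \frac{s+1}{2}\,n+O(1)$; (2) $\displaystyle \frac{s}{2}n \le \mathrm{sat}^\ast(n,S_{t+1,s+1}) \le \frac{\left(\left\lceil\frac{t+1}{s}\right\rceil+2\right)s}{\left(\left\lceil\frac{t+1}{s}\right\rceil+2\right)s+1}\cdot \frac{s+1}{2}\,n+O(1)$.
   Context: All graphs are finite and simple. The double star $S_{t+1,s+1}$ is the tree constructed from $K_2$ by appending $t$ pendant vertices to one of its vertices and $s$ pendant vertices to the other (so these two vertices have degrees $t+1$ and $s+1$). A graph $G$ is $H$-saturated if $G$ has no subgraph isomorphic to $H$, but adding any non-edge to $G$ creates a subgraph isomorphic to $H$; $\mathrm{sat}(n,H)$ is the minimum number of edges in an $H$-saturated graph on $n$ vertices. An edge-colouring of a graph is proper if any two distinct edges sharing a vertex receive different colours. A rainbow copy of $H$ in an edge-coloured graph $G$ is a subgraph of $G$ isomorphic to $H$ all of whose edges have distinct colours. A graph $G$ is properly rainbow $H$-saturated if (1) there is a proper edge-colouring of $G$ containing no rainbow copy of $H$, and (2) for every non-edge $e \notin E(G)$ (a pair of distinct non-adjacent vertices of $G$), every proper edge-colouring of $G+e$ contains a rainbow copy of $H$. The proper rainbow saturation number $\mathrm{sat}^\ast(n,H)$ is the minimum number of edges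 in a properly rainbow $H$-saturated graph on $n$ vertices. The $O(1)$ terms are as $n\to\infty$ with $s,t$ fixed, i.e. bounded in absolute value by a constant depending only on $s$ and $t$; "sufficiently large" means larger than a constant depending only on $s$ and $t$. *)

theory Defs
  imports Complex_Main
begin

type_synonym 'a ugraph = "'a set \<times> 'a set set"

abbreviation verts :: "'a ugraph \<Rightarrow> 'a set" where "verts \<equiv> fst"
abbreviation edges :: "'a ugraph \<Rightarrow> 'a set set" where "edges \<equiv> snd"

definition simple_graph :: "'a ugraph \<Rightarrow> bool" where
  "simple_graph G \<longleftrightarrow>
     finite (verts G) \<and> edges G \<subseteq> {{x, y} | x y. x \<in> verts G \<and> y \<in> verts G \<and> x \<noteq> y}"

definition subgraph :: "'a ugraph \<Rightarrow> 'a ugraph \<Rightarrow> bool" where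
  "subgraph G' G \<longleftrightarrow> simple_graph G' \<and> verts G' \<subseteq> verts G \<and> edges G' \<subseteq> edges G"

definition isomorphic :: "'a ugraph \<Rightarrow> 'b ugraph \<Rightarrow> bool" where
  "isomorphic G H \<longleftrightarrow>
     (\<exists>f. bij_betw f (verts G) (verts H) \<and>
          (\<forall>x\<in>verts G. \<forall>y\<in>verts G. {x, y} \<in> edges G \<longleftrightarrow> {f x, f y} \<in> edges H))"

definition add_edge :: "'a ugraph \<Rightarrow> 'a \<Rightarrow> 'a \<Rightarrow> 'a ugraph" where
  "add_edge G x y = (verts G, insert {x, y} (edges G))"

definition has_copy :: "'b ugraph \<Rightarrow> 'a ugraph \<Rightarrow> bool" where
  "has_copy H G \<longleftrightarrow> (\<exists>G'. subgraph G' G \<and> isomorphic G' H)"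

definition saturated :: "'b ugraph \<Rightarrow> 'a ugraph \<Rightarrow> bool" where
  "saturated H G \<longleftrightarrow>
     \<not> has_copy H G \<and>
     (\<forall>x\<in>verts G. \<forall>y\<in>verts G. x \<noteq> y \<and> {x, y} \<notin> edges G \<longrightarrow> has_copy H (add_edge G x y))"

text \<open>Colours are natural numbers, which is no restriction as all graphs are finite.
  Values of a colouring outside the edge set are irrelevant.\<close>

definition proper_colouring :: "'a ugraph \<Rightarrow> ('a set \<Rightarrow> nat) \<Rightarrow> bool" where
  "proper_colouring G c \<longleftrightarrow>
     (\<forall>e\<in>edges G. \<forall>e'\<in>edges G. e \<noteq> e' \<and> e \<inter> e' \<noteq> {} \<longrightarrow> c e \<noteq> c e')"

definition has_rainbow_copy :: "'b ugraph \<Rightarrow> 'a ugraph \<Rightarrow> ('a set \<Rightarrow> nat) \<Rightarrow> bool" where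
  "has_rainbow_copy H G c \<longleftrightarrow>
     (\<exists>G'. subgraph G' G \<and> isomorphic G' H \<and> inj_on c (edges G'))"

definition properly_rainbow_saturated :: "'b ugraph \<Rightarrow> 'a ugraph \<Rightarrow> bool" where
  "properly_rainbow_saturated H G \<longleftrightarrow>
     (\<exists>c. proper_colouring G c \<and> \<not> has_rainbow_copy H G c) \<and>
     (\<forall>x\<in>verts G. \<forall>y\<in>verts G. x \<noteq> y \<and> {x, y} \<notin> edges G \<longrightarrow>
        (\<forall>c. proper_colouring (add_edge G x y) c \<longrightarrow> has_rainbow_copy H (add_edge G x y) c))"

text \<open>Every finite graph is isomorphic to one whose vertices are natural numbers, so it
  suffices to minimise over these. The minima exist as soon as \<open>H\<close> has an edge, see
  \<open>saturated_exists\<close> and \<open>properly_rainbow_saturated_exists\<close> below.\<close>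

definition sat :: "nat \<Rightarrow> 'b ugraph \<Rightarrow> nat" where
  "sat n H = (LEAST m. \<exists>G :: nat ugraph.
     simple_graph G \<and> card (verts G) = n \<and> saturated H G \<and> card (edges G) = m)"

definition rainbow_sat :: "nat \<Rightarrow> 'b ugraph \<Rightarrow> nat" where
  "rainbow_sat n H = (LEAST m. \<exists>G :: nat ugraph.
     simple_graph G \<and> card (verts G) = n \<and> properly_rainbow_saturated H G \<and> card (edges G) = m)"

datatype ds_vertex = Centre1 | Centre2 | Leaf1 nat | Leaf2 nat

text \<open>The indices \<open>a, b \<ge> 1\<close> are the degrees of the two centres, so these carry
  \<open>a - 1\<close> and \<open>b - 1\<close> leaves, respectively.\<close>

definition double_star :: "nat \<Rightarrow> nat \<Rightarrow> ds_vertex ugraph" where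
  "double_star a b =
     ({Centre1, Centre2} \<union> Leaf1 ` {1..<a} \<union> Leaf2 ` {1..<b},
      {{Centre1, Centre2}} \<union> {{Centre1, Leaf1 i} | i. i \<in> {1..<a}}
                          \<union> {{Centre2, Leaf2 i} | i. i \<in> {1..<b}})"

lemma simple_graph_double_star: "simple_graph (double_star a b)"
proof -
  have "\<exists>x y. e = {x, y} \<and> x \<in> verts (double_star a b) \<and> y \<in> verts (double_star a b) \<and> x \<noteq> y"
    if e: "e \<in> edges (double_star a b)" for e
  proof -
    consider "e = {Centre1, Centre2}"
      | i where "i \<in> {1..<a}" "e = {Centre1, Leaf1 i}"
      | i where "i \<in> {1..<b}" "e = {Centre2, Leaf2 i}"
      using e unfolding double_star_def snd_conv by blast
    then show ?thesis
    proof cases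
      case 1
      then show ?thesis
        by (intro exI[of _ Centre1] exI[of _ Centre2]) (simp add: double_star_def)
    next
      case (2 i)
      then show ?thesis
        by (intro exI[of _ Centre1] exI[of _ "Leaf1 i"]) (simp add: double_star_def)
    next
      case (3 i)
      then show ?thesis
        by (intro exI[of _ Centre2] exI[of _ "Leaf2 i"]) (simp add: double_star_def)
    qed
  qed
  moreover have "finite (verts (double_star a b))"
    by (simp add: double_star_def)
  ultimately show ?thesis
    unfolding simple_graph_def by (simp add: subset_iff)
qed

lemma no_copy_edgeless:
  assumes "simple_graph H" "edges H \<noteq> {}" "subgraph G' (V, {})"
  shows "\<not> isomorphic G' H"
proof
  assume "isomorphic G' H"
  then obtain f where f: "bij_betw f (verts G') (verts H)"
    "\<forall>x\<in>verts G'. \<forall>y\<in>verts G'. {x, y} \<in> edges G' \<longleftrightarrow> {f x, f y} \<in> edges H"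
    unfolding isomorphic_def by blast
  obtain u v where uv: "u \<in> verts H" "v \<in> verts H" "{u, v} \<in> edges H"
    using assms(1,2) unfolding simple_graph_def by blast
  have surj: "f ` verts G' = verts H"
    using f(1) by (rule bij_betw_imp_surj_on)
  obtain x where x: "x \<in> verts G'" "u = f x" using uv(1) surj by blast
  obtain y where y: "y \<in> verts G'" "v = f y" using uv(2) surj by blast
  have "{x, y} \<in> edges G'"
    using f(2) uv(3) x y by simp
  moreover have "edges G' = {}"
    using assms(3) by (simp add: subgraph_def)
  ultimately show False by simp
qed

lemma maximal_graph_exists:
  assumes "P ({..<n::nat}, {})"
  shows "\<exists>G. simple_graph G \<and> card (verts G) = n \<and> P G \<and>
    (\<forall>x\<in>verts G. \<forall>y\<in>verts G. x \<noteq> y \<and> {x, y} \<notin> edges G \<longrightarrow> \<not> P (add_edge G x y))"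
proof -
  let ?V = "{..<n}"
  let ?A = "{E. E \<subseteq> {{x, y} | x y. x \<in> ?V \<and> y \<in> ?V \<and> x \<noteq> y} \<and> P (?V, E)}"
  have "?A \<subseteq> Pow (Pow ?V)" by blast
  then have "finite ?A" by (rule finite_subset) simp
  moreover have "{} \<in> ?A" using assms by simp
  ultimately have "\<exists>E\<in>?A. \<forall>E'\<in>?A. E \<subseteq> E' \<longrightarrow> E = E'"
    by (intro finite_has_maximal) (simp_all only: empty_iff not_False_eq_True, metis empty_iff)
  then obtain E where E: "E \<in> ?A" and max: "\<forall>E'\<in>?A. E \<subseteq> E' \<longrightarrow> E = E'"
    by (elim bexE)
  have "\<not> P (add_edge (?V, E) x y)" if "x \<in> ?V" "y \<in> ?V" "x \<noteq> y" "{x, y} \<notin> E" for x y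
  proof
    assume "P (add_edge (?V, E) x y)"
    then have "insert {x, y} E \<in> ?A"
      using E that(1-3) by (auto simp: add_edge_def)
    with max have "E \<subseteq> insert {x, y} E \<longrightarrow> E = insert {x, y} E"
      by (rule bspec)
    then show False using that(4) by (metis insertI1 subset_insertI)
  qed
  moreover have "simple_graph (?V, E)" "P (?V, E)"
    using E unfolding simple_graph_def by simp_all
  ultimately show ?thesis by (intro exI[of _ "(?V, E)"]) simp
qed

lemma saturated_exists:
  assumes "simple_graph H" "edges H \<noteq> {}"
  shows "\<exists>G :: nat ugraph. simple_graph G \<and> card (verts G) = n \<and> saturated H G"
proof -
  have "\<not> has_copy H ({..<n}, {})"
    using no_copy_edgeless[OF assms] unfolding has_copy_def by blast
  from maximal_graph_exists[of "\<lambda>G. \<not> has_copy H G", OF this]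
  show ?thesis unfolding saturated_def by (simp only: not_not)
qed

lemma properly_rainbow_saturated_exists:
  assumes "simple_graph H" "edges H \<noteq> {}"
  shows "\<exists>G :: nat ugraph. simple_graph G \<and> card (verts G) = n \<and> properly_rainbow_saturated H G"
proof -
  have "\<exists>c. proper_colouring ({..<n}, {}) c \<and> \<not> has_rainbow_copy H ({..<n}, {}) c"
  proof (intro exI conjI)
    show "proper_colouring ({..<n}, {}) (\<lambda>_. 0)"
      unfolding proper_colouring_def by simp
    show "\<not> has_rainbow_copy H ({..<n}, {}) (\<lambda>_. 0)"
      using no_copy_edgeless[OF assms] unfolding has_rainbow_copy_def by blast
  qed
  from maximal_graph_exists[of "\<lambda>G. \<exists>c. proper_colouring G c \<and> \<not> has_rainbow_copy H G c", OF this]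
  show ?thesis unfolding properly_rainbow_saturated_def by (simp only: not_ex de_Morgan_conj not_not imp_conv_disj)
qed

end

theory Submission
  imports Defs
begin

text \<open>
  Upper bounds: take disjoint windmills, each consisting of at least \<open>k\<close> copies of \<open>K\<^sub>s\<^sub>+\<^sub>1\<close>
  glued along a common hub. Only hubs have degree above \<open>s\<close> and no two hubs are adjacent, so there
  is no double star. A new edge either joins two hubs or raises the degree of a vertex next to a
  hub to \<open>s + 1\<close>; in both cases a hub has enough neighbours to choose \<open>t\<close> leaves avoiding the
  leaves (at most \<open>s\<close> conflicts) and, in the rainbow case, the colours (at most \<open>s\<close> more) at the
  other centre.

  Lower bound: if \<open>v\<close> has degree below \<open>s\<close>, then for every non-neighbour \<open>w\<close> the rainbow copy
  created by \<open>vw\<close> has \<open>v\<close> as a leaf and \<open>w\<close> as a centre. Hence the vertices of degree below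
  \<open>s\<close> form a clique, with total deficit at most \<open>s\<^sup>2\<close>, and almost all vertices have a neighbour of
  degree above \<open>s\<close>. For large \<open>n\<close>, the excess at the latter compensates the deficit.
\<close>

subsection \<open>Degrees\<close>

definition nbrs :: "'a ugraph \<Rightarrow> 'a \<Rightarrow> 'a set" where
  "nbrs G v = {w. {v, w} \<in> edges G}"

definition degree :: "'a ugraph \<Rightarrow> 'a \<Rightarrow> nat" where
  "degree G v = card (nbrs G v)"

lemma nbrs_iff: "w \<in> nbrs G v \<longleftrightarrow> {v, w} \<in> edges G"
  by (simp add: nbrs_def)

lemma simple_graphD:
  assumes "simple_graph G" "{v, w} \<in> edges G"
  shows "v \<in> verts G" "w \<in> verts G" "v \<noteq> w"
  using assms unfolding simple_graph_def by (auto simp: doubleton_eq_iff subset_iff)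

lemma nbrs_subset_verts: "simple_graph G \<Longrightarrow> nbrs G v \<subseteq> verts G - {v}"
  by (auto simp: nbrs_def dest: simple_graphD)

lemma finite_verts: "simple_graph G \<Longrightarrow> finite (verts G)"
  by (simp add: simple_graph_def)

lemma finite_nbrs [intro]: "simple_graph G \<Longrightarrow> finite (nbrs G v)"
  by (meson finite_Diff finite_subset finite_verts nbrs_subset_verts)

lemma finite_edges: "simple_graph G \<Longrightarrow> finite (edges G)"
  by (rule finite_subset[of _ "Pow (verts G)"]) (auto simp: simple_graph_def)

lemma card_edge:
  assumes "simple_graph G" "e \<in> edges G"
  shows "e \<subseteq> verts G" "card e = 2"
proof -
  obtain x y where "e = {x, y}" "x \<in> verts G" "y \<in> verts G" "x \<noteq> y"
    using assms unfolding simple_graph_def by blast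
  then show "e \<subseteq> verts G" "card e = 2"
    by auto
qed

text \<open>Double counting of incident pairs of a vertex and an edge; \<open>w\<close> in
  \<open>nbrs G v\<close> corresponds to the edge \<open>{v, w}\<close>.\<close>

lemma sum_degree:
  assumes "simple_graph G"
  shows "(\<Sum>v\<in>verts G. degree G v) = 2 * card (edges G)"
proof -
  have deg: "degree G v = card {e \<in> edges G. v \<in> e}" for v
  proof -
    have "bij_betw (\<lambda>w. {v, w}) (nbrs G v) {e \<in> edges G. v \<in> e}"
    proof (rule bij_betw_imageI)
      show "inj_on (\<lambda>w. {v, w}) (nbrs G v)"
        by (auto simp: inj_on_def doubleton_eq_iff)
      show "(\<lambda>w. {v, w}) ` nbrs G v = {e \<in> edges G. v \<in> e}"
      proof (intro equalityI subsetI)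
        fix e assume e: "e \<in> {e \<in> edges G. v \<in> e}"
        then obtain x y where "e = {x, y}"
          using assms unfolding simple_graph_def by blast
        with e have "e = {v, x} \<or> e = {v, y}"
          by auto
        with e show "e \<in> (\<lambda>w. {v, w}) ` nbrs G v"
          by (auto simp: nbrs_def)
      qed (auto simp: nbrs_def)
    qed
    then show ?thesis
      unfolding degree_def by (rule bij_betw_same_card)
  qed
  have "{v \<in> verts G. v \<in> e} = e" if "e \<in> edges G" for e
    using card_edge(1)[OF assms that] by blast
  then have "\<forall>e\<in>edges G. card {v \<in> verts G. v \<in> e} = 2"
    using card_edge(2)[OF assms] by simp
  from sum_multicount[OF finite_verts[OF assms] finite_edges[OF assms] this] show ?thesis
    by (simp add: deg)
qed

lemma simple_graph_add_edge:
  "simple_graph G \<Longrightarrow> x \<in> verts G \<Longrightarrow> y \<in> verts G \<Longrightarrow> x \<noteq> y \<Longrightarrow> simple_graph (add_edge G x y)"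
  by (auto simp: simple_graph_def add_edge_def)

lemma nbrs_add_edge:
  "nbrs (add_edge G x y) v =
     nbrs G v \<union> (if v = x then {y} else {}) \<union> (if v = y then {x} else {})"
  by (auto simp: nbrs_def add_edge_def doubleton_eq_iff)

lemma degree_mono: "simple_graph G \<Longrightarrow> edges G' \<subseteq> edges G \<Longrightarrow> degree G' v \<le> degree G v"
  unfolding degree_def by (intro card_mono) (auto simp: nbrs_def finite_nbrs[unfolded nbrs_def])

lemma degree_add_edge_le:
  assumes "simple_graph G" "x \<noteq> y"
  shows "degree (add_edge G x y) v \<le> (if v = x \<or> v = y then Suc (degree G v) else degree G v)"
  using assms by (auto simp: degree_def nbrs_add_edge intro: card_insert_le_m1 le_SucI
      simp: card_insert_if finite_nbrs)

lemma degree_add_edge_ge: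
  assumes "simple_graph G" "{x, y} \<notin> edges G"
  shows "Suc (degree G x) \<le> degree (add_edge G x y) x" "Suc (degree G y) \<le> degree (add_edge G x y) y"
proof -
  have "y \<notin> nbrs G x" "x \<notin> nbrs G y"
    using assms(2) by (auto simp: nbrs_def insert_commute)
  then show "Suc (degree G x) \<le> degree (add_edge G x y) x" "Suc (degree G y) \<le> degree (add_edge G x y) y"
    using assms(1) by (auto simp: degree_def nbrs_add_edge finite_nbrs)
qed

subsection \<open>Copies of double stars\<close>

text \<open>Pulls back only what the later arguments use. Lower bounds on the degrees of the centres
  rule out copies in hub graphs; that every edge meets a centre serves to locate an added edge
  inside a copy.\<close>

lemma double_star_copyE:
  assumes "simple_graph G" "isomorphic G (double_star (a + 1) (b + 1))"
  obtains u v where "{u, v} \<in> edges G" "a + 1 \<le> degree G u" "b + 1 \<le> degree G v"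
    "\<forall>e\<in>edges G. u \<in> e \<or> v \<in> e"
proof -
  let ?H = "double_star (a + 1) (b + 1)"
  obtain f where bij: "bij_betw f (verts G) (verts ?H)"
    and f: "\<And>x y. x \<in> verts G \<Longrightarrow> y \<in> verts G \<Longrightarrow> {x, y} \<in> edges G \<longleftrightarrow> {f x, f y} \<in> edges ?H"
    using assms(2) unfolding isomorphic_def by blast
  define g where "g = inv_into (verts G) f"
  have g: "g x \<in> verts G" "f (g x) = x" if "x \<in> verts ?H" for x
    using that bij by (auto simp: g_def bij_betw_def inv_into_into f_inv_into_f)
  have ginj: "inj_on g (verts ?H)"
    by (metis g(2) inj_onI)
  have edge: "{g x, g y} \<in> edges G" if "{x, y} \<in> edges ?H" for x y
    using f[of "g x" "g y"] g simple_graphD[OF simple_graph_double_star that] that by simp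
  have deg: "card S \<le> degree G (g x)" if "\<And>y. y \<in> S \<Longrightarrow> {x, y} \<in> edges ?H" for x S
  proof -
    have "S \<subseteq> verts ?H"
      using that simple_graphD(2)[OF simple_graph_double_star] by blast
    then have "card S = card (g ` S)"
      by (metis card_image ginj inj_on_subset)
    also have "\<dots> \<le> degree G (g x)"
      unfolding degree_def using that edge by (intro card_mono finite_nbrs assms(1)) (auto simp: nbrs_def)
    finally show ?thesis .
  qed
  show thesis
  proof
    show "{g Centre1, g Centre2} \<in> edges G"
      by (rule edge) (simp add: double_star_def)
    have "card (insert Centre2 (Leaf1 ` {1..<a + 1})) \<le> degree G (g Centre1)"
      by (rule deg) (auto simp: double_star_def)
    moreover have "card (Leaf1 ` {1..<a + 1}) = a"
      by (subst card_image) (auto simp: inj_on_def)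
    ultimately show "a + 1 \<le> degree G (g Centre1)"
      by (subst (asm) card_insert_disjoint) auto
    have "card (insert Centre1 (Leaf2 ` {1..<b + 1})) \<le> degree G (g Centre2)"
      by (rule deg) (auto simp: double_star_def insert_commute)
    moreover have "card (Leaf2 ` {1..<b + 1}) = b"
      by (subst card_image) (auto simp: inj_on_def)
    ultimately show "b + 1 \<le> degree G (g Centre2)"
      by (subst (asm) card_insert_disjoint) auto
    show "\<forall>e\<in>edges G. g Centre1 \<in> e \<or> g Centre2 \<in> e"
    proof
      fix e assume e: "e \<in> edges G"
      then obtain x y where xy: "e = {x, y}" "x \<in> verts G" "y \<in> verts G"
        using assms(1) unfolding simple_graph_def by blast
      then have "{f x, f y} \<in> edges ?H"
        using e f by simp
      then have "Centre1 \<in> {f x, f y} \<or> Centre2 \<in> {f x, f y}"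
        by (auto simp: double_star_def)
      moreover have "g (f x) = x" "g (f y) = y"
        using xy bij by (simp_all add: g_def bij_betw_inv_into_left)
      ultimately show "g Centre1 \<in> e \<or> g Centre2 \<in> e"
        using xy(1) by auto
    qed
  qed
qed

text \<open>The edge set of the copy is part of the conclusion because the rainbow version has to
  compare the colours of these particular edges.\<close>

lemma double_star_copyI:
  assumes G: "simple_graph G" and uv: "{u, v} \<in> edges G"
    and X: "X \<subseteq> nbrs G u - {v}" "card X = a" and Y: "Y \<subseteq> nbrs G v - {u}" "card Y = b"
    and disj: "X \<inter> Y = {}"
  shows "\<exists>G'. subgraph G' G \<and> isomorphic G' (double_star (a + 1) (b + 1)) \<and>
    edges G' = insert {u, v} ((\<lambda>x. {u, x}) ` X \<union> (\<lambda>y. {v, y}) ` Y)"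
proof -
  let ?H = "double_star (a + 1) (b + 1)"
  let ?E = "insert {u, v} ((\<lambda>x. {u, x}) ` X \<union> (\<lambda>y. {v, y}) ` Y)"
  define G' where "G' = ({u, v} \<union> X \<union> Y, ?E)"
  have fin: "finite X" "finite Y"
    using X(1) Y(1) G by (meson finite_Diff finite_nbrs finite_subset)+
  have ne: "u \<noteq> v" "u \<notin> X" "v \<notin> X" "u \<notin> Y" "v \<notin> Y"
    using uv X(1) Y(1) nbrs_subset_verts[OF G] simple_graphD(3)[OF G] by blast+
  have sub: "subgraph G' G"
    unfolding subgraph_def
  proof (intro conjI)
    show "simple_graph G'"
      using fin ne by (auto simp: simple_graph_def G'_def)
    show "verts G' \<subseteq> verts G"
      using uv X(1) Y(1) nbrs_subset_verts[OF G] simple_graphD[OF G] by (fastforce simp: G'_def)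
    show "edges G' \<subseteq> edges G"
      using uv X(1) Y(1) by (auto simp: G'_def nbrs_def)
  qed
  obtain p where p: "bij_betw p X {1..<a + 1}"
    using fin X(2) by (metis add_diff_cancel_right' card_atLeastLessThan finite_atLeastLessThan
        finite_same_card_bij)
  obtain r where r: "bij_betw r Y {1..<b + 1}"
    using fin Y(2) by (metis add_diff_cancel_right' card_atLeastLessThan finite_atLeastLessThan
        finite_same_card_bij)
  define f where "f z = (if z = u then Centre1 else if z = v then Centre2
      else if z \<in> X then Leaf1 (p z) else Leaf2 (r z))" for z
  have f: "f u = Centre1" "f v = Centre2" "z \<in> X \<Longrightarrow> f z = Leaf1 (p z)"
    "z \<in> Y \<Longrightarrow> f z = Leaf2 (r z)" for z
    using ne disj by (auto simp: f_def)
  have inj: "inj_on f (verts G')"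
    using p r f by (auto simp: G'_def inj_on_def bij_betw_def)
  have fX: "f ` X = Leaf1 ` {1..<a + 1}"
    using p f(3) unfolding bij_betw_def by (metis (no_types, lifting) image_cong image_image)
  have fY: "f ` Y = Leaf2 ` {1..<b + 1}"
    using r f(4) unfolding bij_betw_def by (metis (no_types, lifting) image_cong image_image)
  have fV: "f ` verts G' = verts ?H"
    using f(1,2) fX fY by (simp add: G'_def double_star_def image_Un insert_commute)
  have "(`) f ` edges G' = insert {Centre1, Centre2}
      ((\<lambda>x. {Centre1, x}) ` (f ` X) \<union> (\<lambda>y. {Centre2, y}) ` (f ` Y))"
    using f(1,2) by (simp add: G'_def image_Un image_image)
  also have "\<dots> = edges ?H"
    unfolding fX fY by (auto simp: double_star_def)
  finally have fE: "(`) f ` edges G' = edges ?H" .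
  \<comment> \<open>Forwards this is \<open>fE\<close>. Backwards, some edge of \<open>G'\<close>
    has the same image as \<open>{x, y}\<close>, and injectivity of \<open>f\<close> on
    \<open>verts G'\<close> identifies the two sets.\<close>
  have "{x, y} \<in> edges G' \<longleftrightarrow> {f x, f y} \<in> edges ?H" if "x \<in> verts G'" "y \<in> verts G'" for x y
  proof
    assume "{x, y} \<in> edges G'"
    then have "f ` {x, y} \<in> edges ?H"
      using fE by blast
    then show "{f x, f y} \<in> edges ?H"
      by simp
  next
    assume "{f x, f y} \<in> edges ?H"
    then obtain e where e: "e \<in> edges G'" "f ` e = f ` {x, y}"
      unfolding fE[symmetric] by auto
    have "e \<subseteq> verts G'"
      using sub card_edge(1)[OF _ e(1)] by (simp add: subgraph_def)
    then have "e = {x, y}"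
      using inj_on_image_eq_iff[OF inj, of e "{x, y}"] e(2) that by simp
    then show "{x, y} \<in> edges G'"
      using e(1) by simp
  qed
  then have "isomorphic G' ?H"
    unfolding isomorphic_def using inj fV by (auto simp: bij_betw_def)
  moreover have "edges G' = ?E"
    by (simp add: G'_def)
  ultimately show ?thesis
    using sub by (intro exI[of _ G'] conjI)
qed

text \<open>Greedy choice: pick the \<open>b\<close> leaves at \<open>v\<close> first. They block at
  most \<open>b\<close> of the at least \<open>a + b\<close> neighbours of \<open>u\<close> other
  than \<open>v\<close>.\<close>

lemma has_copy_double_starI:
  assumes G: "simple_graph G" and uv: "{u, v} \<in> edges G"
    and "a + b + 1 \<le> degree G u" "b + 1 \<le> degree G v"
  shows "has_copy (double_star (a + 1) (b + 1)) G"
proof -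
  have "v \<in> nbrs G u" "u \<in> nbrs G v"
    using uv by (simp_all add: nbrs_def insert_commute)
  then have c: "a + b \<le> card (nbrs G u - {v})" "b \<le> card (nbrs G v - {u})"
    using assms(3,4) by (simp_all add: degree_def)
  obtain Y where Y: "Y \<subseteq> nbrs G v - {u}" "card Y = b" "finite Y"
    using obtain_subset_with_card_n[OF c(2)] by blast
  have "a \<le> card (nbrs G u - {v} - Y)"
    using c(1) Y(2) diff_card_le_card_Diff[OF Y(3), of "nbrs G u - {v}"] by linarith
  from obtain_subset_with_card_n[OF this]
  obtain X where X: "X \<subseteq> nbrs G u - {v} - Y" "card X = a"
    by blast
  then have "X \<subseteq> nbrs G u - {v}" "X \<inter> Y = {}"
    by blast+
  from double_star_copyI[OF G uv this(1) X(2) Y(1,2) this(2)] show ?thesis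
    unfolding has_copy_def by blast
qed

text \<open>As in the uncoloured case, but leaves at \<open>u\<close> must also avoid the colours
  used at \<open>v\<close>. This blocks at most \<open>b\<close> further neighbours, whence
  \<open>2 * b\<close> in the degree condition.\<close>

lemma has_rainbow_copy_double_starI:
  assumes G: "simple_graph G" and uv: "{u, v} \<in> edges G" and c: "proper_colouring G c"
    and "a + 2 * b + 1 \<le> degree G u" "b + 1 \<le> degree G v"
  shows "has_rainbow_copy (double_star (a + 1) (b + 1)) G c"
proof -
  have "v \<in> nbrs G u" "u \<in> nbrs G v"
    using uv by (simp_all add: nbrs_def insert_commute)
  then have card: "a + 2 * b \<le> card (nbrs G u - {v})" "b \<le> card (nbrs G v - {u})"
    using assms(4,5) by (simp_all add: degree_def)
  obtain Y where Y: "Y \<subseteq> nbrs G v - {u}" "card Y = b" "finite Y"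
    using obtain_subset_with_card_n[OF card(2)] by blast
  let ?C = "(\<lambda>y. c {v, y}) ` Y"
  define Z where "Z = {z \<in> nbrs G u. c {u, z} \<in> ?C}"
  have adj: "c {x, y} \<noteq> c {x, z}" if "{x, y} \<in> edges G" "{x, z} \<in> edges G" "y \<noteq> z" for x y z
    using c that unfolding proper_colouring_def by (auto simp: doubleton_eq_iff)
  \<comment> \<open>Edges at \<open>u\<close> have pairwise different colours, so each of the at
    most \<open>b\<close> colours in \<open>?C\<close> excludes at most one neighbour of
    \<open>u\<close>.\<close>
  have "inj_on (\<lambda>z. c {u, z}) Z"
    using adj by (auto simp: inj_on_def Z_def nbrs_def)
  then have "card Z \<le> card ?C"
    using Y(3) by (intro card_inj_on_le[of "\<lambda>z. c {u, z}"]) (auto simp: Z_def)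
  also have "\<dots> \<le> b"
    using Y(2,3) card_image_le by blast
  finally have "card (Y \<union> Z) \<le> 2 * b"
    using card_Un_le[of Y Z] Y(2) by linarith
  moreover have "finite (Y \<union> Z)"
    using Y(3) finite_nbrs[OF G] by (simp add: Z_def)
  ultimately have "a \<le> card (nbrs G u - {v} - (Y \<union> Z))"
    using card(1) diff_card_le_card_Diff[of "Y \<union> Z" "nbrs G u - {v}"] by fastforce
  from obtain_subset_with_card_n[OF this]
  obtain X where X: "X \<subseteq> nbrs G u - {v} - (Y \<union> Z)" "card X = a"
    by blast
  then have "X \<subseteq> nbrs G u - {v}" "X \<inter> Y = {}"
    by blast+
  from double_star_copyI[OF G uv this(1) X(2) Y(1,2) this(2)]
  obtain G' where G': "subgraph G' G" "isomorphic G' (double_star (a + 1) (b + 1))"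
    and E': "edges G' = insert {u, v} ((\<lambda>x. {u, x}) ` X \<union> (\<lambda>y. {v, y}) ` Y)"
    by metis
  \<comment> \<open>Two disjoint edges of a double star are leaf edges at different centres,
    separated by the choice of \<open>X\<close> outside \<open>Z\<close>; for edges that meet,
    properness of \<open>c\<close> suffices.\<close>
  have "c e \<noteq> c e'" if e: "e \<in> edges G'" "e' \<in> edges G'" "e \<noteq> e'" for e e'
  proof (cases "e \<inter> e' = {}")
    case True
    then have "\<exists>x\<in>X. \<exists>y\<in>Y. e = {u, x} \<and> e' = {v, y} \<or> e = {v, y} \<and> e' = {u, x}"
      using e(1,2) unfolding E' by auto
    then obtain x y where xy: "x \<in> X" "y \<in> Y" "e = {u, x} \<and> e' = {v, y} \<or> e = {v, y} \<and> e' = {u, x}"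
      by blast
    then have "c {u, x} \<noteq> c {v, y}"
      using X(1) by (auto simp: Z_def)
    then show ?thesis
      using xy(3) by auto
  next
    case False
    then show ?thesis
      using e c G'(1) unfolding proper_colouring_def subgraph_def by blast
  qed
  then have "inj_on c (edges G')"
    by (auto simp: inj_on_def)
  then show ?thesis
    using G' unfolding has_rainbow_copy_def by blast
qed

subsection \<open>Graphs with independent hubs\<close>

text \<open>Common abstraction for both upper bounds: \<open>D\<close> is \<open>t + s + 1\<close>
  for ordinary and \<open>t + 2 * s + 1\<close> for rainbow saturation. Both exceed
  \<open>s\<close>, so the last clause makes the hubs independent. Hub degrees are only bounded
  below, which leaves room to realise every large number of vertices.\<close>

definition hub_graph :: "nat \<Rightarrow> nat \<Rightarrow> 'a ugraph \<Rightarrow> bool" where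
  "hub_graph s D G \<longleftrightarrow> simple_graph G \<and>
     (\<forall>v\<in>verts G. D \<le> degree G v \<or> degree G v = s \<and> (\<exists>u. {u, v} \<in> edges G \<and> D \<le> degree G u)) \<and>
     (\<forall>u v. {u, v} \<in> edges G \<longrightarrow> degree G u \<le> s \<or> degree G v \<le> s)"

text \<open>As \<open>s \<le> t\<close>, the centres of a copy would be adjacent vertices of degree
  above \<open>s\<close>.\<close>

lemma hub_graph_no_copy:
  assumes "hub_graph s D G" "s \<le> t"
  shows "\<not> has_copy (double_star (t + 1) (s + 1)) G"
proof
  assume "has_copy (double_star (t + 1) (s + 1)) G"
  then obtain G' where G': "subgraph G' G" "isomorphic G' (double_star (t + 1) (s + 1))"
    unfolding has_copy_def by blast
  then have simp: "simple_graph G'" and sub: "edges G' \<subseteq> edges G"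
    by (auto simp: subgraph_def)
  obtain u v where uv: "{u, v} \<in> edges G'" "t + 1 \<le> degree G' u" "s + 1 \<le> degree G' v"
    and "\<forall>e\<in>edges G'. u \<in> e \<or> v \<in> e"
    by (rule double_star_copyE[OF simp G'(2)])
  have le: "degree G' w \<le> degree G w" for w
    using degree_mono[OF _ sub] assms(1) by (simp add: hub_graph_def)
  have "s < degree G u" "s < degree G v"
    using uv(2,3) le[of u] le[of v] assms(2) by linarith+
  moreover have "{u, v} \<in> edges G"
    using uv(1) sub ..
  ultimately show False
    using assms(1) unfolding hub_graph_def by (meson leD)
qed

text \<open>Finds the central edge of the future copy. If an endpoint of the new edge has degree
  \<open>s\<close>, it is the old edge from that endpoint to a hub; if both endpoints are hubs, it
  is the new edge itself.\<close>

lemma hub_graph_add_edge: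
  assumes hub: "hub_graph s D G" and D: "s \<le> D"
    and xy: "x \<in> verts G" "y \<in> verts G" "x \<noteq> y" "{x, y} \<notin> edges G"
  obtains u v where "{u, v} \<in> edges (add_edge G x y)" "D \<le> degree (add_edge G x y) u"
    "s + 1 \<le> degree (add_edge G x y) v"
proof -
  have G: "simple_graph G"
    using hub by (simp add: hub_graph_def)
  have sub: "edges G \<subseteq> edges (add_edge G x y)"
    by (auto simp: add_edge_def)
  have mono: "degree G w \<le> degree (add_edge G x y) w" for w
    using degree_mono[OF simple_graph_add_edge[OF G xy(1-3)] sub] .
  consider u v where "v \<in> {x, y}" "degree G v = s" "{u, v} \<in> edges G" "D \<le> degree G u"
    | "D \<le> degree G x" "D \<le> degree G y"
    using hub xy(1,2) unfolding hub_graph_def by blast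
  then show thesis
  proof cases
    case (1 u v)
    then have "s + 1 \<le> degree (add_edge G x y) v"
      using degree_add_edge_ge[OF G xy(4)] by auto
    then show thesis
      using that[of u v] 1 mono[of u] sub by auto
  next
    case 2
    then have "D \<le> degree (add_edge G x y) x" "s + 1 \<le> degree (add_edge G x y) y"
      using degree_add_edge_ge[OF G xy(4)] D by auto
    then show thesis
      using that[of x y] by (simp add: add_edge_def)
  qed
qed

lemma hub_graph_saturated:
  assumes "hub_graph s (t + s + 1) G" "s \<le> t"
  shows "saturated (double_star (t + 1) (s + 1)) G"
  unfolding saturated_def
proof (intro conjI ballI impI)
  show "\<not> has_copy (double_star (t + 1) (s + 1)) G"
    using hub_graph_no_copy[OF assms] .
next
  fix x y assume xy: "x \<in> verts G" "y \<in> verts G" "x \<noteq> y \<and> {x, y} \<notin> edges G"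
  have G: "simple_graph (add_edge G x y)"
    using assms(1) xy simple_graph_add_edge by (metis hub_graph_def)
  show "has_copy (double_star (t + 1) (s + 1)) (add_edge G x y)"
    using hub_graph_add_edge[OF assms(1) _ xy(1,2)] has_copy_double_starI[OF G] xy(3)
    by (metis add.commute le_add1 trans_le_add1)
qed

lemma hub_graph_properly_rainbow_saturated:
  assumes "hub_graph s (t + 2 * s + 1) G" "s \<le> t"
  shows "properly_rainbow_saturated (double_star (t + 1) (s + 1)) G"
  unfolding properly_rainbow_saturated_def
proof (intro conjI ballI impI allI)
  have "finite (edges G)"
    using assms(1) finite_edges by (metis hub_graph_def)
  \<comment> \<open>Any proper colouring works, since \<open>G\<close> has no copy at all; giving
    all edges different colours is the simplest one.\<close>
  then obtain c :: "'a set \<Rightarrow> nat" where "inj_on c (edges G)"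
    using finite_imp_inj_to_nat_seg by blast
  then have "proper_colouring G c"
    by (auto simp: proper_colouring_def inj_on_def)
  moreover have "\<not> has_rainbow_copy (double_star (t + 1) (s + 1)) G c"
    using hub_graph_no_copy[OF assms] by (auto simp: has_rainbow_copy_def has_copy_def)
  ultimately show "\<exists>c. proper_colouring G c \<and> \<not> has_rainbow_copy (double_star (t + 1) (s + 1)) G c"
    by blast
next
  fix x y c assume xy: "x \<in> verts G" "y \<in> verts G" "x \<noteq> y \<and> {x, y} \<notin> edges G"
    and c: "proper_colouring (add_edge G x y) c"
  have G: "simple_graph (add_edge G x y)"
    using assms(1) xy simple_graph_add_edge by (metis hub_graph_def)
  obtain u v where "{u, v} \<in> edges (add_edge G x y)"
    "t + 2 * s + 1 \<le> degree (add_edge G x y) u" "s + 1 \<le> degree (add_edge G x y) v"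
    using hub_graph_add_edge[OF assms(1) _ xy(1,2)] xy(3) by auto
  then show "has_rainbow_copy (double_star (t + 1) (s + 1)) (add_edge G x y) c"
    using has_rainbow_copy_double_starI[OF G _ c] by blast
qed

subsection \<open>Windmills\<close>

text \<open>The hubs are the vertices below \<open>q\<close>; the \<open>j\<close>-th clique is attached to the hub \<open>j mod q\<close>.\<close>

definition blade :: "nat \<Rightarrow> nat \<Rightarrow> nat \<Rightarrow> nat set" where
  "blade q s j = insert (j mod q) {q + s * j..<q + s * j + s}"

definition windmills :: "nat \<Rightarrow> nat \<Rightarrow> nat \<Rightarrow> nat ugraph" where
  "windmills q s m = ({..<q + s * m}, \<Union>j<m. {e. e \<subseteq> blade q s j \<and> card e = 2})"

lemma card_blade: "0 < q \<Longrightarrow> card (blade q s j) = s + 1"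
  using mod_less_divisor[of q j] by (auto simp: blade_def card_insert_if simp del: mod_less_divisor)

lemma blade_subset:
  assumes "0 < q" "j < m"
  shows "blade q s j \<subseteq> {..<q + s * m}"
proof -
  have "s * j + s \<le> s * m"
    using assms(2) by (metis Suc_leI add.commute mult_Suc_right mult_le_mono2)
  then show ?thesis
    using mod_less_divisor[OF assms(1), of j] by (auto simp: blade_def)
qed

lemma windmills_edge_iff:
  "{x, y} \<in> edges (windmills q s m) \<longleftrightarrow> x \<noteq> y \<and> (\<exists>j<m. x \<in> blade q s j \<and> y \<in> blade q s j)"
  by (auto simp: windmills_def card_insert_if)

lemma simple_graph_windmills: "0 < q \<Longrightarrow> simple_graph (windmills q s m)"
  using blade_subset[of q _ m s] by (fastforce simp: simple_graph_def windmills_def card_2_iff)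

text \<open>A vertex that is not a hub lies in only one blade, so its neighbours are exactly the
  other \<open>s\<close> vertices of that blade.\<close>

lemma blade_eq:
  assumes "q \<le> x" "x \<in> blade q s j" "0 < q"
  shows "(x - q) div s = j"
proof -
  have "x \<noteq> j mod q"
    using assms(1,3) mod_less_divisor[of q j] by linarith
  then obtain i where "i < s" "x = q + s * j + i"
    using assms(2) by (auto simp: blade_def le_iff_add)
  then show ?thesis
    by simp
qed

text \<open>Only an upper bound is needed, so a union bound over the \<open>m\<close> cliques on
  \<open>s + 1\<close> vertices is enough.\<close>

lemma card_edges_windmills:
  assumes "0 < q"
  shows "2 * card (edges (windmills q s m)) \<le> s * m * (s + 1)"
proof -
  have fin: "finite (blade q s j)" for j
    by (simp add: blade_def)
  have "card (edges (windmills q s m)) \<le> (\<Sum>j<m. card {e. e \<subseteq> blade q s j \<and> card e = 2})"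
    unfolding windmills_def snd_conv by (rule card_UN_le) simp
  also have "\<dots> = m * ((s + 1) choose 2)"
    by (simp add: n_subsets[OF fin] card_blade[OF assms])
  finally have "2 * card (edges (windmills q s m)) \<le> m * (2 * ((s + 1) choose 2))"
    by simp
  also have "2 * ((s + 1) choose 2) = s * (s + 1)"
    by (simp add: choose_two)
  finally show ?thesis
    by (simp add: mult_ac)
qed

text \<open>The condition \<open>k * q \<le> m\<close> gives every residue class modulo
  \<open>q\<close> at least \<open>k\<close> indices below \<open>m\<close>. Each hub thus carries
  at least \<open>k\<close> blades, each contributing \<open>s\<close> neighbours.\<close>

lemma hub_graph_windmills:
  assumes q: "0 < q" and s: "0 < s" and m: "k * q \<le> m" and D: "D \<le> k * s"
  shows "hub_graph s D (windmills q s m)"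
proof -
  let ?G = "windmills q s m"
  note G = simple_graph_windmills[OF q, of s m]
  have rim: "degree ?G v = s" if v: "q \<le> v" "v \<in> blade q s j" "j < m" for v j
  proof -
    have "nbrs ?G v = blade q s j - {v}"
      using blade_eq[OF v(1) _ q] v(2,3) by (auto simp: nbrs_def windmills_edge_iff)
    then show ?thesis
      using v(2) card_blade[OF q] by (simp add: degree_def blade_def)
  qed
  have hub: "D \<le> degree ?G i" if i: "i < q" for i
  proof -
    \<comment> \<open>Enumerates the non-hub vertices of the blades \<open>i + q * l\<close> with
      \<open>l < k\<close>, all of which are attached to hub \<open>i\<close>.\<close>
    define h where "h = (\<lambda>(l, r). q + s * (i + q * l) + r)"
    have "inj_on h ({..<k} \<times> {..<s})"
    proof (rule inj_onI)
      fix p p' assume p: "p \<in> {..<k} \<times> {..<s}" "p' \<in> {..<k} \<times> {..<s}" and "h p = h p'"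
      then obtain l r l' r' where lr: "p = (l, r)" "p' = (l', r')" "r < s" "r' < s"
        and eq: "s * (i + q * l) + r = s * (i + q * l') + r'"
        by (auto simp: h_def)
      have "r = r'"
        using arg_cong[OF eq, of "\<lambda>x. x mod s"] lr by simp
      then show "p = p'"
        using eq lr q s by simp
    qed
    moreover have "h ` ({..<k} \<times> {..<s}) \<subseteq> nbrs ?G i"
    proof
      fix x assume "x \<in> h ` ({..<k} \<times> {..<s})"
      then obtain l r where lr: "l < k" "r < s" "x = q + s * (i + q * l) + r"
        by (auto simp: h_def)
      have "i + q * l < q * Suc l"
        using i by simp
      also have "\<dots> \<le> q * k"
        using lr(1) by (intro mult_le_mono2) simp
      finally have "i + q * l < m"
        using m by (simp add: mult.commute)
      moreover have "i \<in> blade q s (i + q * l)" "x \<in> blade q s (i + q * l)"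
        using i lr by (auto simp: blade_def)
      moreover have "i \<noteq> x"
        using i lr(3) by simp
      ultimately show "x \<in> nbrs ?G i"
        unfolding nbrs_iff windmills_edge_iff by blast
    qed
    ultimately have "k * s \<le> degree ?G i"
      using card_inj_on_le[of h "{..<k} \<times> {..<s}"] finite_nbrs[OF G]
      by (simp add: degree_def)
    then show ?thesis
      using D by simp
  qed
  have "D \<le> degree ?G v \<or> degree ?G v = s \<and> (\<exists>u. {u, v} \<in> edges ?G \<and> D \<le> degree ?G u)"
    if v: "v \<in> verts ?G" for v
  proof (cases "v < q")
    case False
    define j where "j = (v - q) div s"
    have lt: "v - q < m * s"
      using v False by (auto simp: windmills_def mult.commute)
    have j: "j < m"
      using less_mult_imp_div_less[OF lt] by (simp add: j_def)
    have "v = q + s * j + (v - q) mod s"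
      using False by (simp add: j_def)
    then have vj: "v \<in> blade q s j"
      using mod_less_divisor[OF s, of "v - q"]
      by (metis atLeastLessThan_iff blade_def insertI2 le_add1 nat_add_left_cancel_less)
    have hq: "j mod q < q"
      using q by simp
    have "{j mod q, v} \<in> edges ?G"
      using j vj hq False unfolding windmills_edge_iff by (auto simp: blade_def)
    then show ?thesis
      using rim[OF _ vj j] hub[OF hq] False by auto
  qed (use hub in blast)
  moreover have "degree ?G u \<le> s \<or> degree ?G v \<le> s" if "{u, v} \<in> edges ?G" for u v
  proof -
    obtain j where j: "u \<noteq> v" "j < m" "u \<in> blade q s j" "v \<in> blade q s j"
      using \<open>{u, v} \<in> edges ?G\<close> unfolding windmills_edge_iff by blast
    \<comment> \<open>A blade contains just one vertex below \<open>q\<close>.\<close>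
    then have "q \<le> u \<or> q \<le> v"
      by (auto simp: blade_def)
    then show ?thesis
      using rim j by (metis order_refl)
  qed
  ultimately show ?thesis
    using G by (simp add: hub_graph_def)
qed

text \<open>With \<open>n = q + s * m\<close> vertices, windmills have at most
  \<open>(n - q) * (s + 1) / 2\<close> edges, so \<open>q\<close> should be as large as
  \<open>k * q \<le> m\<close> permits, about \<open>n / (k * s + 1)\<close>. Making
  \<open>s\<close> divide \<open>n - q\<close> costs at most \<open>s\<close> hubs, which is
  absorbed in the additive constant.\<close>

lemma hub_graph_exists:
  assumes s: "0 < s" and D: "D \<le> k * s" and n: "(s + 1) * (k * s + 1) \<le> n"
  shows "\<exists>G :: nat ugraph. hub_graph s D G \<and> card (verts G) = n \<and>
    real (card (edges G)) \<le> real (k * s) / real (k * s + 1) * ((real s + 1) / 2) * real n + (real s + 1)\<^sup>2 / 2"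
proof -
  define q0 where "q0 = n div (k * s + 1)"
  text \<open>The largest \<open>q < q0\<close> that is congruent to \<open>n\<close> modulo \<open>s\<close>.\<close>
  define q where "q = q0 - (s - (n - q0) mod s)"
  \<comment> \<open>The \<open>+ 1\<close> is right even if \<open>s\<close> divides
    \<open>n - q0\<close>: then \<open>q = q0 - s\<close>, and the \<open>s\<close> vertices gained
    form one more blade.\<close>
  define m where "m = (n - q0) div s + 1"
  have q0: "s + 1 \<le> q0"
    unfolding q0_def using n by (subst less_eq_div_iff_mult_less_eq) auto
  have q0n: "q0 * (k * s + 1) \<le> n"
    unfolding q0_def by (rule div_times_less_eq_dividend)
  have "q0 \<le> n"
    unfolding q0_def by (rule div_le_dividend)
  have lt: "(n - q0) mod s < s"
    using s by simp
  have dm: "s * ((n - q0) div s) + (n - q0) mod s = n - q0"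
    by simp
  have nq: "n = q + s * m"
    using q0 lt dm \<open>q0 \<le> n\<close> unfolding q_def m_def by (simp add: algebra_simps)
  have q: "0 < q" "q \<le> q0" "q0 \<le> q + s"
    using q0 lt by (auto simp: q_def)
  have "q * (k * s + 1) \<le> q + s * m"
    using q0n q(2) nq by (metis le_trans mult_le_mono1)
  then have "s * (k * q) \<le> s * m"
    by (simp add: algebra_simps)
  then have km: "k * q \<le> m"
    using s by simp
  let ?K = "real (k * s)"
  \<comment> \<open>Rounding in \<open>q0\<close> loses less than 1 and passing to \<open>q\<close>
    at most \<open>s\<close>, so \<open>n / (k * s + 1)\<close> is at most \<open>q + s + 1\<close>.
    Multiplied by \<open>(s + 1) / 2\<close>, the loss \<open>s + 1\<close> becomes the additive
    constant.\<close>
  have "n < (q0 + 1) * (k * s + 1)"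
    unfolding q0_def by (metis Suc_eq_plus1 dividend_less_div_times mult_Suc add.commute zero_less_Suc)
  also have "\<dots> \<le> (q + s + 1) * (k * s + 1)"
    using q(3) by (intro mult_le_mono1) simp
  finally have "real n \<le> real ((q + s + 1) * (k * s + 1))"
    by (simp only: of_nat_le_iff)
  then have "real n \<le> (real q + real s + 1) * (?K + 1)"
    by (simp only: of_nat_add of_nat_mult of_nat_1)
  then have "real n / (?K + 1) \<le> real q + real s + 1"
    by (subst pos_divide_le_eq) (auto simp: add_nonneg_pos)
  moreover have "?K / (?K + 1) * real n = real n - real n / (?K + 1)"
    by (simp add: field_simps add_nonneg_eq_0_iff)
  ultimately have "real n - real q \<le> ?K / (?K + 1) * real n + (real s + 1)"
    by linarith
  then have "(real n - real q) * ((real s + 1) / 2) \<le> (?K / (?K + 1) * real n + (real s + 1)) * ((real s + 1) / 2)"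
    by (intro mult_right_mono) auto
  also have "\<dots> = ?K / (?K + 1) * ((real s + 1) / 2) * real n + (real s + 1)\<^sup>2 / 2"
    by (simp add: algebra_simps power2_eq_square add_divide_distrib)
  finally have bound: "(real n - real q) * ((real s + 1) / 2) \<le> \<dots>" .
  have "real (2 * card (edges (windmills q s m))) \<le> real (s * m * (s + 1))"
    using card_edges_windmills[OF q(1)] of_nat_le_iff by blast
  then have "real (card (edges (windmills q s m))) \<le> (real n - real q) * ((real s + 1) / 2)"
    using nq by (simp add: field_simps)
  from order_trans[OF this bound] have "real (card (edges (windmills q s m)))
      \<le> real (k * s) / real (k * s + 1) * ((real s + 1) / 2) * real n + (real s + 1)\<^sup>2 / 2"
    by (simp only: of_nat_add of_nat_1)
  then show ?thesis
    using hub_graph_windmills[OF q(1) s km D] nq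
    by (intro exI[of _ "windmills q s m"]) (simp add: windmills_def)
qed

subsection \<open>The lower bound\<close>

text \<open>Give \<open>{v, w}\<close> a fresh colour in a good colouring of \<open>G\<close>. The
  resulting rainbow copy must use this edge, so one end is a centre. Even with the new edge
  \<open>v\<close> has degree at most \<open>s\<close>, so the centre is \<open>w\<close>; the other
  centre \<open>u\<close> keeps its degree and is joined to \<open>w\<close> by an old edge.\<close>

lemma low_degree_non_neighbour:
  assumes G: "simple_graph G" and st: "s \<le> t"
    and sat: "properly_rainbow_saturated (double_star (t + 1) (s + 1)) G"
    and v: "v \<in> verts G" "degree G v < s" and w: "w \<in> verts G" "v \<noteq> w" "{v, w} \<notin> edges G"
  shows "s \<le> degree G w \<and> (\<exists>u. {u, w} \<in> edges G \<and> s + 1 \<le> degree G u)"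
proof -
  let ?H = "double_star (t + 1) (s + 1)" and ?G = "add_edge G v w"
  obtain c where c: "proper_colouring G c" "\<not> has_rainbow_copy ?H G c"
    using sat unfolding properly_rainbow_saturated_def by blast
  \<comment> \<open>Inserting 0 keeps \<open>Max\<close> meaningful if \<open>G\<close> has no
    edges.\<close>
  define c' where "c' = c({v, w} := Suc (Max (insert 0 (c ` edges G))))"
  have c'_old: "c' e = c e" if "e \<in> edges G" for e
    using that w(3) by (auto simp: c'_def)
  have c'_new: "c e < c' {v, w}" if "e \<in> edges G" for e
    using that finite_edges[OF G] by (auto simp: c'_def less_Suc_eq_le intro!: Max_ge)
  have "proper_colouring ?G c'"
    unfolding proper_colouring_def
  proof (intro ballI impI)
    fix e e' assume "e \<in> edges ?G" "e' \<in> edges ?G" "e \<noteq> e' \<and> e \<inter> e' \<noteq> {}"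
    then consider "e \<in> edges G" "e' \<in> edges G" "e \<noteq> e'" "e \<inter> e' \<noteq> {}"
      | "e = {v, w}" "e' \<in> edges G" | "e' = {v, w}" "e \<in> edges G"
      by (auto simp: add_edge_def)
    then show "c' e \<noteq> c' e'"
    proof cases
      case 1
      then show ?thesis
        using c(1) c'_old unfolding proper_colouring_def by simp
    next
      case 2
      then show ?thesis
        using c'_new[of e'] c'_old[of e'] by simp
    next
      case 3
      then show ?thesis
        using c'_new[of e] c'_old[of e] by simp
    qed
  qed
  then have "has_rainbow_copy ?H ?G c'"
    using sat v(1) w unfolding properly_rainbow_saturated_def by blast
  then obtain G' where G': "subgraph G' ?G" "isomorphic G' ?H" "inj_on c' (edges G')"
    unfolding has_rainbow_copy_def by blast
  have G's: "simple_graph G'" and sub: "edges G' \<subseteq> edges ?G"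
    using G'(1) by (auto simp: subgraph_def)
  have new: "{v, w} \<in> edges G'"
  proof (rule ccontr)
    assume "{v, w} \<notin> edges G'"
    then have "subgraph G' G"
      using G'(1) by (auto simp: subgraph_def add_edge_def)
    moreover from this have "inj_on c (edges G')"
      using G'(3) c'_old unfolding inj_on_def subgraph_def by (metis subsetD)
    ultimately show False
      using c(2) G'(2) unfolding has_rainbow_copy_def by blast
  qed
  obtain a b where ab: "{a, b} \<in> edges G'" "t + 1 \<le> degree G' a" "s + 1 \<le> degree G' b"
    and cover: "\<forall>e\<in>edges G'. a \<in> e \<or> b \<in> e"
    by (rule double_star_copyE[OF G's G'(2)])
  have "degree G' z \<le> degree ?G z" for z
    using degree_mono[OF simple_graph_add_edge[OF G v(1) w(1,2)] sub] .
  \<comment> \<open>As \<open>s \<le> t\<close>, both centres have degree at least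
    \<open>s + 1\<close> after the addition; which of them carries the \<open>t\<close> leaves no
    longer matters.\<close>
  then have deg: "s + 1 \<le> (if z = v \<or> z = w then Suc (degree G z) else degree G z)" if "z = a \<or> z = b" for z
    using degree_add_edge_le[OF G w(2), of z] that ab(2,3) st
    by (smt (verit) add_le_mono1 le_trans)
  have "a \<noteq> v" "b \<noteq> v"
    using deg[of a] deg[of b] v(2) by auto
  moreover have "a \<noteq> b"
    using simple_graphD(3)[OF G's ab(1)] .
  ultimately obtain u where u: "u = a \<or> u = b" "w = a \<or> w = b" "u \<noteq> v" "u \<noteq> w" "{u, w} = {a, b}"
    using bspec[OF cover new] by (metis insertE insert_commute singletonD)
  have "{u, w} \<noteq> {v, w}"
    using u(3,4) by (auto simp: doubleton_eq_iff)
  moreover have "{u, w} \<in> edges ?G"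
    unfolding u(5) using ab(1) sub ..
  ultimately have "{u, w} \<in> edges G"
    by (simp add: add_edge_def)
  moreover have "s + 1 \<le> degree G u" "s \<le> degree G w"
    using deg[OF u(1)] deg[OF u(2)] u(3,4) by auto
  ultimately show ?thesis
    by blast
qed

text \<open>Compares the deficit of the vertices in \<open>A\<close> with the excess of those in
  \<open>B\<close>. All of \<open>A\<close> lies in the closed neighbourhood of one low vertex, so
  the deficit is at most \<open>s\<^sup>2\<close>; the excess is shown to be at least that.\<close>

lemma properly_rainbow_saturated_edges_ge:
  assumes G: "simple_graph G" and st: "s \<le> t"
    and sat: "properly_rainbow_saturated (double_star (t + 1) (s + 1)) G"
    and n: "(s + 1) ^ 3 + s\<^sup>2 \<le> card (verts G)"
  shows "s * card (verts G) \<le> 2 * card (edges G)"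
proof (cases "\<exists>v\<in>verts G. degree G v < s")
  case False
  then have "(\<Sum>v\<in>verts G. s) \<le> (\<Sum>v\<in>verts G. degree G v)"
    by (intro sum_mono) (simp add: not_less)
  then show ?thesis
    unfolding sum_degree[OF G] by (simp add: mult.commute)
next
  case True
  then obtain v where v: "v \<in> verts G" "degree G v < s"
    by blast
  define A where "A = {x \<in> verts G. degree G x < s}"
  define B where "B = {x \<in> verts G. s < degree G x}"
  have fin: "finite (verts G)" "finite A" "finite B"
    using finite_verts[OF G] by (auto simp: A_def B_def)
  note low = low_degree_non_neighbour[OF G st sat]
  have "A \<subseteq> insert v (nbrs G v)"
    using low[OF v] by (force simp: A_def nbrs_def)
  then have "card A \<le> card (insert v (nbrs G v))"
    using finite_nbrs[OF G] by (intro card_mono) auto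
  then have cardA: "card A \<le> s"
    using v(2) finite_nbrs[OF G] by (simp add: degree_def card_insert_if split: if_splits)
  have surplus: "s\<^sup>2 \<le> (\<Sum>x\<in>B. degree G x - s)"
  \<comment> \<open>If \<open>B\<close> is large, an excess of 1 per vertex suffices. If it is
    small, its few vertices must still be adjacent to all but at most \<open>s\<close> vertices of
    \<open>G\<close>, so for large \<open>n\<close> their degrees have a large sum.\<close>
  proof (cases "s\<^sup>2 \<le> card B")
    case True
    also have "card B = (\<Sum>x\<in>B. 1)"
      by simp
    also have "\<dots> \<le> (\<Sum>x\<in>B. degree G x - s)"
      by (intro sum_mono) (auto simp: B_def)
    finally show ?thesis .
  next
    case False
    have "verts G \<subseteq> insert v (nbrs G v) \<union> (\<Union>x\<in>B. nbrs G x)"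
    proof
      fix w assume w: "w \<in> verts G"
      show "w \<in> insert v (nbrs G v) \<union> (\<Union>x\<in>B. nbrs G x)"
      proof (cases "w = v \<or> {v, w} \<in> edges G")
        case False
        then obtain u where "{u, w} \<in> edges G" "s + 1 \<le> degree G u"
          using low[OF v w] by metis
        moreover from this have "u \<in> B"
          using simple_graphD(1)[OF G] by (auto simp: B_def)
        ultimately show ?thesis
          by (auto simp: nbrs_def)
      qed (auto simp: nbrs_def)
    qed
    then have "card (verts G) \<le> card (insert v (nbrs G v) \<union> (\<Union>x\<in>B. nbrs G x))"
      using finite_nbrs[OF G] fin by (intro card_mono) auto
    also have "\<dots> \<le> card (insert v (nbrs G v)) + card (\<Union>x\<in>B. nbrs G x)"
      by (rule card_Un_le)
    also have "card (insert v (nbrs G v)) \<le> s"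
      using v(2) finite_nbrs[OF G] by (simp add: degree_def card_insert_if)
    also have "card (\<Union>x\<in>B. nbrs G x) \<le> (\<Sum>x\<in>B. degree G x)"
      unfolding degree_def by (rule card_UN_le[OF fin(3)])
    also have "(\<Sum>x\<in>B. degree G x) = (\<Sum>x\<in>B. s + (degree G x - s))"
      by (intro sum.cong) (auto simp: B_def)
    also have "\<dots> = s * card B + (\<Sum>x\<in>B. degree G x - s)"
      by (simp only: sum.distrib sum_constant of_nat_id mult.commute)
    finally have "card (verts G) \<le> s + (s * card B + (\<Sum>x\<in>B. degree G x - s))"
      by simp
    moreover have "s * card B \<le> s * s\<^sup>2"
      using False by (intro mult_le_mono2) simp
    moreover have "s + s * s\<^sup>2 \<le> (s + 1) ^ 3"
      by (simp add: power2_eq_square power3_eq_cube algebra_simps)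
    ultimately show ?thesis
      using n by linarith
  qed
  have "s * card A \<le> s\<^sup>2"
    using cardA by (simp add: power2_eq_square)
  moreover have "(\<Sum>x\<in>verts G. if x \<in> B then degree G x - s else 0) = (\<Sum>x\<in>B. degree G x - s)"
    using fin by (simp add: sum.If_cases) (auto simp: B_def intro!: sum.cong)
  moreover have "(\<Sum>x\<in>verts G. if x \<in> A then s else 0) = s * card A"
  proof -
    have "verts G \<inter> A = A"
      by (auto simp: A_def)
    then show ?thesis
      using fin by (simp add: sum.If_cases)
  qed
  \<comment> \<open>Each vertex of \<open>A\<close> is credited the full \<open>s\<close> instead of
    its exact deficit. Subtraction occurs only on \<open>B\<close>, where it is not
    truncated.\<close>
  moreover have "(\<Sum>x\<in>verts G. s + (if x \<in> B then degree G x - s else 0))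
      \<le> (\<Sum>x\<in>verts G. degree G x + (if x \<in> A then s else 0))"
    by (intro sum_mono) (auto simp: A_def B_def)
  ultimately have "s * card (verts G) \<le> (\<Sum>x\<in>verts G. degree G x)"
    using surplus by (simp add: sum.distrib mult.commute)
  then show ?thesis
    by (simp add: sum_degree[OF G])
qed

text \<open>Bounding a \<open>LEAST\<close> from below requires that it is attained, hence the
  appeal to \<open>properly_rainbow_saturated_exists\<close>.\<close>

lemma rainbow_sat_ge:
  assumes "s \<le> t" "(s + 1) ^ 3 + s\<^sup>2 \<le> n"
  shows "real s / 2 * real n \<le> real (rainbow_sat n (double_star (t + 1) (s + 1)))"
proof -
  let ?H = "double_star (t + 1) (s + 1)"
  have "edges ?H \<noteq> {}"
    by (simp add: double_star_def)
  then obtain G0 :: "nat ugraph" where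
    "simple_graph G0" "card (verts G0) = n" "properly_rainbow_saturated ?H G0"
    using properly_rainbow_saturated_exists[OF simple_graph_double_star] by blast
  then have "\<exists>m. \<exists>G :: nat ugraph. simple_graph G \<and> card (verts G) = n \<and>
      properly_rainbow_saturated ?H G \<and> card (edges G) = m"
    by blast
  from LeastI_ex[OF this] obtain G :: "nat ugraph" where "simple_graph G" "card (verts G) = n"
    "properly_rainbow_saturated ?H G" "card (edges G) = rainbow_sat n ?H"
    unfolding rainbow_sat_def by blast
  then have "s * n \<le> 2 * rainbow_sat n ?H"
    using properly_rainbow_saturated_edges_ge[of G s t] assms by auto
  then have "real (s * n) \<le> real (2 * rainbow_sat n ?H)"
    by (simp only: of_nat_le_iff)
  then show ?thesis
    by simp
qed

theorem theorem6p9: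
  fixes s t :: nat
  assumes "1 \<le> s" and "s \<le> t"
  shows "\<exists>(C::real) (N::nat). \<forall>n\<ge>N.
    real (sat n (double_star (t + 1) (s + 1)))
      \<le> ((real_of_int \<lceil>(real t + 1) / real s\<rceil> + 1) * real s)
          / ((real_of_int \<lceil>(real t + 1) / real s\<rceil> + 1) * real s + 1)
          * ((real s + 1) / 2) * real n + C
    \<and> real s / 2 * real n \<le> real (rainbow_sat n (double_star (t + 1) (s + 1)))
    \<and> real (rainbow_sat n (double_star (t + 1) (s + 1)))
      \<le> ((real_of_int \<lceil>(real t + 1) / real s\<rceil> + 2) * real s)
          / ((real_of_int \<lceil>(real t + 1) / real s\<rceil> + 2) * real s + 1)
          * ((real s + 1) / 2) * real n + C"
proof -
  let ?H = "double_star (t + 1) (s + 1)"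
  define k where "k = nat \<lceil>(real t + 1) / real s\<rceil>"
  have s: "0 < s"
    using assms(1) by simp
  have k: "real_of_int \<lceil>(real t + 1) / real s\<rceil> = real k"
    unfolding k_def by simp
  have "(real t + 1) / real s \<le> real k"
    using k le_of_int_ceiling[of "(real t + 1) / real s"] by simp
  then have "real (t + 1) \<le> real (k * s)"
    using s by (simp add: field_simps)
  \<comment> \<open>Adding \<open>s\<close> or \<open>2 * s\<close> on both sides shows that
    \<open>k + 1\<close> or \<open>k + 2\<close> blades per hub reach the hub degree needed for
    ordinary or rainbow saturation.\<close>
  then have ks: "t + 1 \<le> k * s"
    by (simp only: of_nat_le_iff)
  \<comment> \<open>The first summand is large enough for both windmill constructions, the second
    for the lower bound.\<close>
  define N where "N = (s + 1) * ((k + 2) * s + 1) + ((s + 1) ^ 3 + s\<^sup>2)"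
  have main: "real (sat n ?H) \<le> real ((k + 1) * s) / real ((k + 1) * s + 1) * ((real s + 1) / 2) * real n
        + (real s + 1)\<^sup>2 / 2
    \<and> real s / 2 * real n \<le> real (rainbow_sat n ?H)
    \<and> real (rainbow_sat n ?H) \<le> real ((k + 2) * s) / real ((k + 2) * s + 1) * ((real s + 1) / 2) * real n
        + (real s + 1)\<^sup>2 / 2"
    if n: "N \<le> n" for n
  proof (intro conjI)
    have "(s + 1) * ((k + 1) * s + 1) \<le> (s + 1) * ((k + 2) * s + 1)"
      by (intro mult_le_mono2) simp
    then have "(s + 1) * ((k + 1) * s + 1) \<le> n"
      using n unfolding N_def by linarith
    moreover have "t + s + 1 \<le> (k + 1) * s"
      using ks by simp
    ultimately obtain G :: "nat ugraph" where G: "hub_graph s (t + s + 1) G" "card (verts G) = n"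
      "real (card (edges G)) \<le> real ((k + 1) * s) / real ((k + 1) * s + 1) * ((real s + 1) / 2) * real n
        + (real s + 1)\<^sup>2 / 2"
      using hub_graph_exists[OF s] by meson
    then have "sat n ?H \<le> card (edges G)"
      unfolding sat_def using hub_graph_saturated[OF G(1) assms(2)] G(1,2)
      by (intro Least_le exI[of _ G]) (simp add: hub_graph_def)
    with G(3) show "real (sat n ?H)
      \<le> real ((k + 1) * s) / real ((k + 1) * s + 1) * ((real s + 1) / 2) * real n + (real s + 1)\<^sup>2 / 2"
      by (meson le_trans of_nat_mono order_trans)
    have "(s + 1) * ((k + 2) * s + 1) \<le> n"
      using n by (simp add: N_def)
    moreover have "t + 2 * s + 1 \<le> (k + 2) * s"
      using ks by simp
    ultimately obtain G :: "nat ugraph" where G: "hub_graph s (t + 2 * s + 1) G" "card (verts G) = n"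
      "real (card (edges G)) \<le> real ((k + 2) * s) / real ((k + 2) * s + 1) * ((real s + 1) / 2) * real n
        + (real s + 1)\<^sup>2 / 2"
      using hub_graph_exists[OF s] by meson
    then have "rainbow_sat n ?H \<le> card (edges G)"
      unfolding rainbow_sat_def using hub_graph_properly_rainbow_saturated[OF G(1) assms(2)] G(1,2)
      by (intro Least_le exI[of _ G]) (simp add: hub_graph_def)
    with G(3) show "real (rainbow_sat n ?H)
      \<le> real ((k + 2) * s) / real ((k + 2) * s + 1) * ((real s + 1) / 2) * real n + (real s + 1)\<^sup>2 / 2"
      by (meson le_trans of_nat_mono order_trans)
    show "real s / 2 * real n \<le> real (rainbow_sat n ?H)"
      using rainbow_sat_ge[OF assms(2)] n by (simp add: N_def)
  qed
  show ?thesis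
    unfolding k
  proof (intro exI[of _ "(real s + 1)\<^sup>2 / 2"] exI[of _ N] allI impI)
    fix n assume "n \<ge> N"
    from main[OF this] show "real (sat n ?H) \<le> (real k + 1) * real s / ((real k + 1) * real s + 1)
          * ((real s + 1) / 2) * real n + (real s + 1)\<^sup>2 / 2
      \<and> real s / 2 * real n \<le> real (rainbow_sat n ?H)
      \<and> real (rainbow_sat n ?H) \<le> (real k + 2) * real s / ((real k + 2) * real s + 1)
          * ((real s + 1) / 2) * real n + (real s + 1)\<^sup>2 / 2"
      by (simp only: of_nat_add of_nat_mult of_nat_1 of_nat_numeral)
  qed
qed

end
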